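(* Among based closed walks $w$ on $Q_3$, the shortest walk satisfying $a(w)=0$ and $\mu(w)\neq0$ has length $14$. Equivalently, $$\min\bigl\{|w|:\ w\in\mathcal W,\ \rho(w)\in\gamma_2(F_5)\setminus\gamma_3(F_5)\bigr\}=14.$$ The walk $W=(000;01012020101202)$ realizes this minimum.
   Context: $Q_3$ is the $1$-skeleton (graph) of the three-dimensional cube, with vertex set $V=\{0,1\}^3$ and coordinates numbered $0,1,2$; two vertices are adjacent iff they differ in exactly one coordinate. A vertex is written $b_2b_1b_0$ ($b_i$ the $i$-th coordinate) and identified with the integer $4b_2+2b_1+b_0\in\{0,\ldots,7\}$. A step in direction $i$ flips the $i$-th coordinate. The basepoint is $o=000$. A walk is $w=(o;a_1a_2\cdots a_n)$ with $n\ge0$, $a_k\in\{0,1,2\}$; its length is $|w|=n$ and its vertex sequence is $v_0=o,v_1,\ldots,v_n$, where $v_k$ is obtained from $v_{k-1}$ by flipping coordinate $a_k$. It is closed if $v_n=o$. $\mathcal W$ is the monoid of based closed walks under concatenation. Reduced loop word: fix the spanning tree of $Q_3$ given by the path $000,001,011,010,110,111,101,100$ (i.e. $0,1,3,2,6,7,5,4$). The five remaining (cotree) edges $(0,2),(0,4),(1,5),(3,7),(4,6)$ are oriented from the smaller to the larger integer and denoted $x_1,\ldots,x_5$ in this order; $F_5$ is the free group on $x_1,\ldots,x_5$. For $w\in\mathcal W$, reading the steps in order, a forward crossing of the $i$-th cotree edge contributes $x_i$, a backward crossing contributes $x_i^{-1}$, and a tree edge contributes nothing; $\rho(w)\in F_5$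 is the free reduction of the resulting word. Let $s_i^{(k)}\in\{-1,0,1\}$ be the signed contribution of step $k$ to the crossing count of the $i$-th cotree edge ($+1$ forward, $-1$ backward, $0$ otherwise), $a_i^{(0)}=0$, $a_i^{(k)}=\sum_{m=1}^{k}s_i^{(m)}$, and $a(w)=(a_1^{(n)},\ldots,a_5^{(n)})\in\mathbb Z^5$ (this is the image of $\rho(w)$ under abelianization $F_5\to\mathbb Z^5$). For $1\le i<j\le5$ put $$\mu_{ij}(w)=\sum_{k=1}^{n}\bigl(a_i^{(k-1)}s_j^{(k)}-a_j^{(k-1)}s_i^{(k)}\bigr),\qquad \mu(w)=(\mu_{ij}(w))_{1\le i<j\le5}\in\mathbb Z^{10}.$$ Lower central series: $\gamma_1(F_5)=F_5$, $\gamma_{m+1}(F_5)=[\gamma_m(F_5),F_5]$. *)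

theory Defs
  imports "HOL-Algebra.Generated_Groups"
begin

section \<open>Free groups and the lower central series\<close>

text \<open>The letter \<open>(x, True)\<close> stands for the generator \<open>x\<close> and \<open>(x, False)\<close> for its inverse.\<close>

type_synonym 'a letter = "'a \<times> bool"

definition inv_letter :: "'a letter \<Rightarrow> 'a letter" where
  "inv_letter l = (fst l, \<not> snd l)"

definition reduced :: "'a letter list \<Rightarrow> bool" where
  "reduced = successively (\<lambda>l m. m \<noteq> inv_letter l)"

fun push_letter :: "'a letter \<Rightarrow> 'a letter list \<Rightarrow> 'a letter list" where
  "push_letter l [] = [l]"
| "push_letter l (m # ms) = (if m = inv_letter l then ms else l # m # ms)"

definition free_reduce :: "'a letter list \<Rightarrow> 'a letter list" where
  "free_reduce ws = foldr push_letter ws []"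

definition free_group :: "'a set \<Rightarrow> 'a letter list monoid" where
  "free_group X =
     \<lparr> carrier = {ws. reduced ws \<and> fst ` set ws \<subseteq> X},
       mult = (\<lambda>u v. free_reduce (u @ v)),
       one = [] \<rparr>"

text \<open>
  The series is numbered from 1, as usual; the value at 0 is a dummy.  The commutator is
  \<open>[x, y] = x y x\<^sup>-\<^sup>1 y\<^sup>-\<^sup>1\<close>; the other convention yields the same subgroups.
\<close>

primrec lower_central :: "('a, 'b) monoid_scheme \<Rightarrow> nat \<Rightarrow> 'a set" where
  "lower_central G 0 = carrier G"
| "lower_central G (Suc m) =
     (if m = 0 then carrier G
      else generate G (\<Union>x \<in> lower_central G m. \<Union>y \<in> carrier G.
        {x \<otimes>\<^bsub>G\<^esub> y \<otimes>\<^bsub>G\<^esub> inv\<^bsub>G\<^esub> x \<otimes>\<^bsub>G\<^esub> inv\<^bsub>G\<^esub> y}))"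

lemma inv_letter_inv_letter [simp]: "inv_letter (inv_letter l) = l"
  by (simp add: inv_letter_def)

lemma reduced_push: "reduced ws \<Longrightarrow> reduced (push_letter l ws)"
  by (cases ws) (auto simp: reduced_def successively_Cons)

lemma push_push_inv: "reduced ws \<Longrightarrow> push_letter l (push_letter (inv_letter l) ws) = ws"
  by (cases ws; cases "tl ws") (auto simp: reduced_def)

lemma reduced_foldr_push: "reduced t \<Longrightarrow> reduced (foldr push_letter ws t)"
  by (induction ws) (auto intro: reduced_push)

lemma reduced_free_reduce: "reduced (free_reduce ws)"
  unfolding free_reduce_def by (rule reduced_foldr_push) (simp add: reduced_def)

lemma free_reduce_reduced: "reduced ws \<Longrightarrow> free_reduce ws = ws"
proof (induction ws)
  case (Cons l ws)
  then show ?case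
    by (cases ws) (auto simp: free_reduce_def reduced_def)
qed (simp add: free_reduce_def)

lemma foldr_push_push:
  assumes "reduced t"
  shows "foldr push_letter (push_letter l ws) t = push_letter l (foldr push_letter ws t)"
proof (cases ws)
  case (Cons m ms)
  then show ?thesis
    using push_push_inv[OF reduced_foldr_push[OF assms], of l ms] by auto
qed simp

lemma foldr_push_free_reduce:
  "reduced t \<Longrightarrow> foldr push_letter (free_reduce ws) t = foldr push_letter ws t"
  by (induction ws) (simp_all add: free_reduce_def foldr_push_push)

lemma free_reduce_append_left: "free_reduce (free_reduce u @ v) = free_reduce (u @ v)"
proof -
  have "reduced (foldr push_letter v [])"
    by (rule reduced_foldr_push) (simp add: reduced_def)
  then show ?thesis
    using foldr_push_free_reduce by (simp add: free_reduce_def)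
qed

lemma free_reduce_append_right: "free_reduce (u @ free_reduce v) = free_reduce (u @ v)"
proof -
  have "foldr push_letter (free_reduce v) [] = foldr push_letter v []"
    by (rule foldr_push_free_reduce) (simp add: reduced_def)
  then show ?thesis
    by (simp add: free_reduce_def)
qed

lemma set_push: "set (push_letter l ws) \<subseteq> insert l (set ws)"
  by (cases ws) auto

lemma set_free_reduce: "set (free_reduce ws) \<subseteq> set ws"
proof (induction ws)
  case (Cons l ws)
  have "free_reduce (l # ws) = push_letter l (free_reduce ws)"
    by (simp add: free_reduce_def)
  then show ?case
    using set_push[of l "free_reduce ws"] Cons by auto
qed (simp add: free_reduce_def)

lemma free_reduce_inverse: "free_reduce (map inv_letter (rev ws) @ ws) = []"
proof (induction ws)
  case (Cons l ws)
  let ?t = "foldr push_letter ws []"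
  have "reduced ?t"
    by (rule reduced_foldr_push) (simp add: reduced_def)
  then have "push_letter (inv_letter l) (push_letter l ?t) = ?t"
    using push_push_inv[of ?t "inv_letter l"] by simp
  then show ?case
    using Cons by (simp add: free_reduce_def)
qed (simp add: free_reduce_def)

lemma group_free_group: "group (free_group X)"
proof (rule groupI)
  fix u v
  assume "u \<in> carrier (free_group X)" "v \<in> carrier (free_group X)"
  then show "u \<otimes>\<^bsub>free_group X\<^esub> v \<in> carrier (free_group X)"
    using set_free_reduce[of "u @ v"] by (fastforce simp: free_group_def reduced_free_reduce)
next
  fix u v t
  show "u \<otimes>\<^bsub>free_group X\<^esub> v \<otimes>\<^bsub>free_group X\<^esub> t = u \<otimes>\<^bsub>free_group X\<^esub> (v \<otimes>\<^bsub>free_group X\<^esub> t)"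
    by (simp add: free_group_def free_reduce_append_left free_reduce_append_right)
next
  fix u
  assume u: "u \<in> carrier (free_group X)"
  then have "fst ` set (free_reduce (map inv_letter (rev u))) \<subseteq> X"
    using set_free_reduce[of "map inv_letter (rev u)"]
    by (fastforce simp: free_group_def inv_letter_def)
  then have "free_reduce (map inv_letter (rev u)) \<in> carrier (free_group X)"
    by (simp add: free_group_def reduced_free_reduce)
  moreover have "free_reduce (map inv_letter (rev u)) \<otimes>\<^bsub>free_group X\<^esub> u = \<one>\<^bsub>free_group X\<^esub>"
    by (simp add: free_group_def free_reduce_append_left free_reduce_inverse)
  ultimately show "\<exists>v \<in> carrier (free_group X). v \<otimes>\<^bsub>free_group X\<^esub> u = \<one>\<^bsub>free_group X\<^esub>"
    by blast
qed (auto simp: free_group_def reduced_def free_reduce_reduced)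

section \<open>Based closed walks on the cube graph\<close>

text \<open>
  Vertices of $Q_3$ are the natural numbers below 8, read in binary: bit \<open>i\<close> is the \<open>i\<close>-th
  coordinate, so a step in direction \<open>i\<close> is \<^term>\<open>flip_bit i\<close>.  A walk from the basepoint 0 is the
  list of its directions.
\<close>

definition walk_vertex :: "nat list \<Rightarrow> nat \<Rightarrow> nat" where
  "walk_vertex w k = fold flip_bit (take k w) 0"

definition closed_walks :: "nat list set" where
  "closed_walks = {w. set w \<subseteq> {0, 1, 2} \<and> walk_vertex w (length w) = 0}"

text \<open>
  The edges of $Q_3$ off the spanning path 0, 1, 3, 2, 6, 7, 5, 4, with their orientations;
  they are numbered from 1 to 5.
\<close>

definition cotree_edge :: "nat \<Rightarrow> nat \<times> nat" where
  "cotree_edge i = [(0, 2), (0, 4), (1, 5), (3, 7), (4, 6)] ! (i - 1)"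

text \<open>Signed contribution $s_i^{(k)}$ of step \<open>k \<ge> 1\<close> to cotree edge \<open>i\<close>.\<close>

definition crossing :: "nat list \<Rightarrow> nat \<Rightarrow> nat \<Rightarrow> int" where
  "crossing w i k =
     (if (walk_vertex w (k - 1), walk_vertex w k) = cotree_edge i then 1
      else if (walk_vertex w k, walk_vertex w (k - 1)) = cotree_edge i then - 1
      else 0)"

text \<open>The partial sum $a_i^{(k)}$; the vector $a(w)$ is \<^term>\<open>\<lambda>i. crossing_sum w i (length w)\<close>.\<close>

definition crossing_sum :: "nat list \<Rightarrow> nat \<Rightarrow> nat \<Rightarrow> int" where
  "crossing_sum w i k = (\<Sum>m = 1..k. crossing w i m)"

definition mu :: "nat list \<Rightarrow> nat \<Rightarrow> nat \<Rightarrow> int" where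
  "mu w i j = (\<Sum>k = 1..length w.
     crossing_sum w i (k - 1) * crossing w j k - crossing_sum w j (k - 1) * crossing w i k)"

definition a_zero :: "nat list \<Rightarrow> bool" where
  "a_zero w \<longleftrightarrow> (\<forall>i \<in> {1..5}. crossing_sum w i (length w) = 0)"

definition mu_zero :: "nat list \<Rightarrow> bool" where
  "mu_zero w \<longleftrightarrow> (\<forall>i \<in> {1..5}. \<forall>j \<in> {1..5}. i < j \<longrightarrow> mu w i j = 0)"

abbreviation F5 :: "nat letter list monoid" where
  "F5 \<equiv> free_group {1..5}"

text \<open>At most one \<open>i\<close> contributes a letter to a given step.\<close>

definition step_word :: "nat list \<Rightarrow> nat \<Rightarrow> nat letter list" where
  "step_word w k = concat (map (\<lambda>i.
     if crossing w i k = 1 then [(i, True)]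
     else if crossing w i k = - 1 then [(i, False)]
     else []) [1..<6])"

definition rho :: "nat list \<Rightarrow> nat letter list" where
  "rho w = free_reduce (concat (map (step_word w) [1..<Suc (length w)]))"

lemma rho_in_F5: "rho w \<in> carrier F5"
proof -
  have "fst ` set (step_word w k) \<subseteq> {1..5}" for k
    by (auto simp: step_word_def split: if_splits)
  then show ?thesis
    using set_free_reduce[of "concat (map (step_word w) [1..<Suc (length w)])"]
    unfolding rho_def free_group_def by (fastforce simp: reduced_free_reduce)
qed

end

theory Submission
  imports Defs
begin

text \<open>
  The equality of the two sets of walks is a statement about free groups: a word lies in
  \<open>\<gamma>\<^sub>2\<close> iff all its exponent sums vanish, and in \<open>\<gamma>\<^sub>3\<close> iff in addition all the numbers
  \<open>c\<^sub>i\<^sub>j\<close>, \<open>i \<noteq> j\<close>, vanish, where \<open>c\<^sub>i\<^sub>j\<close> counts, with signs, the pairs consisting of an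
  occurrence of \<open>x\<^sub>i\<close> and a later occurrence of \<open>x\<^sub>j\<close>
  (\<open>lower_central_2_free_group_iff\<close>, \<open>lower_central_3_free_group_iff\<close>).  That these numbers
  vanish on the subgroups is a direct calculation on generators.  Conversely, in a group of
  nilpotency class at most 2, a word can be collected into a product of powers of the generators
  and of their commutators whose exponents are exactly the exponent sums and the \<open>c\<^sub>i\<^sub>j\<close>
  (\<open>hom_free_group_eq_normal_form\<close>); applied to the quotient by \<open>\<gamma>\<^sub>2\<close> or \<open>\<gamma>\<^sub>3\<close>, this shows that
  a word with vanishing invariants lies in the subgroup.  Since
  \<open>c\<^sub>i\<^sub>j + c\<^sub>j\<^sub>i = a\<^sub>i a\<^sub>j\<close> and \<open>\<mu>\<^sub>i\<^sub>j = c\<^sub>i\<^sub>j - c\<^sub>j\<^sub>i\<close>, for \<open>a = 0\<close> the conditions \<open>\<mu> = 0\<close> and \<open>c = 0\<close> agree.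

  The lower bound on the length comes from homotopy.  Let \<open>w\<close> be closed with \<open>a(w) = 0\<close> and
  length at most 12.  It traverses every edge equally often in both directions, so it uses at
  most six edges.  Two distinct cycles of the cube graph have at least seven edges together, so
  the edges used contain at most one cycle, around which \<open>w\<close> winds zero times because
  \<open>a(w) = 0\<close>; so \<open>w\<close> is null-homotopic and \<open>\<rho>(w) = 1\<close>.  What is
  needed of this is that a nonempty such \<open>w\<close> has two consecutive steps in the same direction
  (\<open>short_balanced_walk_backtracks\<close>); it is verified by a search through the non-backtracking
  walks, cut off as soon as the remaining steps cannot bring all crossing counts back to zero.
  Deleting such a pair of steps does not change \<open>\<rho>(w)\<close>, and induction on the length gives
  \<open>\<rho>(w) = 1\<close> (\<open>short_balanced_walk_trivial\<close>).  The length 13 is excluded by parity, and the walk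
  \<open>W\<close> shows that 14 is attained.
\<close>


section \<open>Words and their exponent and pair counts\<close>

text \<open>The sign with which a letter contributes to the generator \<open>i\<close>.\<close>

definition letter_exponent :: "'a \<Rightarrow> 'a letter \<Rightarrow> int" where
  "letter_exponent i l = (if fst l = i then if snd l then 1 else - 1 else 0)"

text \<open>The exponent sum of the generator \<open>i\<close> in a word.\<close>

definition exponent :: "'a \<Rightarrow> 'a letter list \<Rightarrow> int" where
  "exponent i ws = (\<Sum>l\<leftarrow>ws. letter_exponent i l)"

text \<open>
  The number \<open>c\<^sub>i\<^sub>j\<close> of pairs of positions \<open>p < q\<close> with generator \<open>i\<close> at \<open>p\<close> and \<open>j\<close> at \<open>q\<close>, each
  pair weighted by the product of the two signs.  For \<open>i = j\<close> it is not invariant under free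
  reduction and plays no role.
\<close>

primrec pair_count :: "'a \<Rightarrow> 'a \<Rightarrow> 'a letter list \<Rightarrow> int" where
  "pair_count i j [] = 0"
| "pair_count i j (l # ws) = pair_count i j ws + letter_exponent i l * exponent j ws"

lemma exponent_Nil [simp]: "exponent i [] = 0"
  by (simp add: exponent_def)

lemma exponent_Cons [simp]: "exponent i (l # ws) = letter_exponent i l + exponent i ws"
  by (simp add: exponent_def)

lemma exponent_append [simp]: "exponent i (u @ v) = exponent i u + exponent i v"
  by (simp add: exponent_def)

lemma pair_count_append [simp]:
  "pair_count i j (u @ v) = pair_count i j u + pair_count i j v + exponent i u * exponent j v"
  by (induction u) (simp_all add: algebra_simps)

lemma letter_exponent_inv [simp]: "letter_exponent i (inv_letter l) = - letter_exponent i l"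
  by (simp add: letter_exponent_def inv_letter_def)

lemma letter_exponent_mult: "i \<noteq> j \<Longrightarrow> letter_exponent i l * letter_exponent j l = 0"
  by (simp add: letter_exponent_def)

lemma pair_count_shuffle:
  "i \<noteq> j \<Longrightarrow> pair_count i j ws + pair_count j i ws = exponent i ws * exponent j ws"
  by (induction ws) (auto simp: algebra_simps letter_exponent_mult)

lemma exponent_push [simp]: "exponent i (push_letter l ws) = letter_exponent i l + exponent i ws"
  by (cases ws) auto

lemma pair_count_push:
  assumes "i \<noteq> j"
  shows "pair_count i j (push_letter l ws) = pair_count i j (l # ws)"
  using letter_exponent_mult[OF assms, of l] by (cases ws) (auto simp: algebra_simps)

lemma exponent_free_reduce [simp]: "exponent i (free_reduce ws) = exponent i ws"
  by (induction ws) (simp_all add: free_reduce_def)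

lemma pair_count_free_reduce [simp]:
  "i \<noteq> j \<Longrightarrow> pair_count i j (free_reduce ws) = pair_count i j ws"
proof (induction ws)
  case (Cons l ws)
  have "free_reduce (l # ws) = push_letter l (free_reduce ws)"
    by (simp add: free_reduce_def)
  then show ?case
    using Cons by (simp add: pair_count_push)
qed (simp add: free_reduce_def)

text \<open>Each letter changes a single exponent sum, by one.\<close>

lemma sum_abs_exponent_le:
  assumes "finite I"
  shows "(\<Sum>i\<in>I. \<bar>exponent i ws\<bar>) \<le> int (length ws)"
proof (induction ws)
  case (Cons l ws)
  have "(\<Sum>i\<in>I. \<bar>letter_exponent i l\<bar>) = (\<Sum>i\<in>I. if fst l = i then 1 else 0)"
    by (rule sum.cong) (auto simp: letter_exponent_def)
  also have "\<dots> \<le> 1"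
    using assms by simp
  finally have "(\<Sum>i\<in>I. \<bar>letter_exponent i l\<bar>) \<le> 1" .
  moreover have "(\<Sum>i\<in>I. \<bar>exponent i (l # ws)\<bar>)
      \<le> (\<Sum>i\<in>I. \<bar>letter_exponent i l\<bar> + \<bar>exponent i ws\<bar>)"
    by (intro sum_mono) simp
  ultimately show ?case
    using Cons by (simp add: sum.distrib)
qed simp

section \<open>Commutators and the lower central series\<close>

text \<open>The commutator \<open>[x, y] = x y x\<^sup>-\<^sup>1 y\<^sup>-\<^sup>1\<close>, as in \<^const>\<open>lower_central\<close>.\<close>

definition commutator :: "('a, 'b) monoid_scheme \<Rightarrow> 'a \<Rightarrow> 'a \<Rightarrow> 'a" where
  "commutator G x y = x \<otimes>\<^bsub>G\<^esub> y \<otimes>\<^bsub>G\<^esub> inv\<^bsub>G\<^esub> x \<otimes>\<^bsub>G\<^esub> inv\<^bsub>G\<^esub> y"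

lemma lower_central_Suc_Suc:
  "lower_central G (Suc (Suc m)) =
    generate G {commutator G x y | x y. x \<in> lower_central G (Suc m) \<and> y \<in> carrier G}"
proof -
  have "(\<Union>x \<in> lower_central G (Suc m). \<Union>y \<in> carrier G.
        {x \<otimes>\<^bsub>G\<^esub> y \<otimes>\<^bsub>G\<^esub> inv\<^bsub>G\<^esub> x \<otimes>\<^bsub>G\<^esub> inv\<^bsub>G\<^esub> y})
      = {commutator G x y | x y. x \<in> lower_central G (Suc m) \<and> y \<in> carrier G}"
    unfolding commutator_def by blast
  then show ?thesis
    unfolding lower_central.simps(2)[of G "Suc m"] by simp
qed

lemma lower_central_2:
  "lower_central G 2 = generate G {commutator G x y | x y. x \<in> carrier G \<and> y \<in> carrier G}"
  using lower_central_Suc_Suc[of G 0] by (simp add: numeral_2_eq_2)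

lemma lower_central_3:
  "lower_central G 3 = generate G {commutator G x y | x y. x \<in> lower_central G 2 \<and> y \<in> carrier G}"
  using lower_central_Suc_Suc[of G 1] by (simp add: numeral_2_eq_2 numeral_3_eq_3)

context group
begin

lemma commutator_closed [simp]:
  "x \<in> carrier G \<Longrightarrow> y \<in> carrier G \<Longrightarrow> commutator G x y \<in> carrier G"
  by (simp add: commutator_def)

lemma mult_eq_commutator_mult:
  assumes "x \<in> carrier G" "y \<in> carrier G"
  shows "x \<otimes> y = commutator G x y \<otimes> (y \<otimes> x)"
proof -
  have "inv y \<otimes> (y \<otimes> x) = x"
    using assms by (simp flip: m_assoc)
  then show ?thesis
    using assms by (simp add: commutator_def m_assoc)
qed

lemma commutator_eqI:
  assumes "x \<in> carrier G" "y \<in> carrier G" "c \<in> carrier G" "x \<otimes> y = c \<otimes> (y \<otimes> x)"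
  shows "commutator G x y = c"
proof -
  have "commutator G x y \<otimes> (y \<otimes> x) = c \<otimes> (y \<otimes> x)"
    using assms mult_eq_commutator_mult[of x y] by simp
  then show ?thesis
    using assms by (meson commutator_closed m_closed right_cancel)
qed

lemma commutator_conjugate:
  assumes "x \<in> carrier G" "y \<in> carrier G" "g \<in> carrier G"
  shows "g \<otimes> commutator G x y \<otimes> inv g = commutator G (g \<otimes> x \<otimes> inv g) (g \<otimes> y \<otimes> inv g)"
proof -
  have cancel: "inv g \<otimes> (g \<otimes> z) = z" if "z \<in> carrier G" for z
    using that assms by (simp flip: m_assoc)
  show ?thesis
    using assms by (simp add: commutator_def m_assoc inv_mult_group cancel)
qed

lemma normal_lower_central: "lower_central G m \<lhd> G"
proof (induction m)
  case 0
  show ?case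
    by (simp add: normal_inv_iff subgroup_self)
next
  case (Suc m)
  show ?case
  proof (cases m)
    case 0
    then show ?thesis
      by (simp add: normal_inv_iff subgroup_self)
  next
    case (Suc k)
    interpret N: normal "lower_central G (Suc k)" G
      using Suc.IH Suc by simp
    show ?thesis
      unfolding Suc lower_central_Suc_Suc
    proof (rule normal_generateI)
      show "{commutator G x y | x y. x \<in> lower_central G (Suc k) \<and> y \<in> carrier G} \<subseteq> carrier G"
        using N.mem_carrier by auto
    next
      fix h g
      assume "h \<in> {commutator G x y | x y. x \<in> lower_central G (Suc k) \<and> y \<in> carrier G}"
        and g: "g \<in> carrier G"
      then obtain x y where xy: "h = commutator G x y" "x \<in> lower_central G (Suc k)" "y \<in> carrier G"
        by blast
      then have "g \<otimes> h \<otimes> inv g = commutator G (g \<otimes> x \<otimes> inv g) (g \<otimes> y \<otimes> inv g)"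
        using g N.mem_carrier commutator_conjugate by metis
      moreover have "g \<otimes> x \<otimes> inv g \<in> lower_central G (Suc k)"
        using N.inv_op_closed2 g xy by blast
      moreover have "g \<otimes> y \<otimes> inv g \<in> carrier G"
        using g xy by simp
      ultimately show "g \<otimes> h \<otimes> inv g
          \<in> {commutator G x y | x y. x \<in> lower_central G (Suc k) \<and> y \<in> carrier G}"
        by blast
    qed
  qed
qed

text \<open>
  The product of the powers \<open>x\<^sub>k\<^bsup>f k\<^esup>\<close> in the order given by the list.
\<close>

primrec ordered_prod :: "('k \<Rightarrow> 'a) \<Rightarrow> ('k \<Rightarrow> int) \<Rightarrow> 'k list \<Rightarrow> 'a" where
  "ordered_prod x f [] = \<one>"
| "ordered_prod x f (k # ks) = x k [^] f k \<otimes> ordered_prod x f ks"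

text \<open>
  The collected form with exponents \<open>a\<close> of the elements \<open>x\<^sub>k\<close> and exponents \<open>c i j\<close> of the
  commutators \<open>[x\<^sub>i, x\<^sub>j]\<close>, where \<open>i\<close> comes after \<open>j\<close> in the list.  The commutators with a given
  second entry \<open>x\<^sub>k\<close> are gathered into the single commutator \<open>[\<Prod>\<^sub>i x\<^sub>i\<^bsup>c i k\<^esup>, x\<^sub>k]\<close>, which is the
  product of the \<open>[x\<^sub>i, x\<^sub>k]\<^bsup>c i k\<^esup>\<close> when commutators are central.
\<close>

primrec normal_form :: "('k \<Rightarrow> 'a) \<Rightarrow> ('k \<Rightarrow> int) \<Rightarrow> ('k \<Rightarrow> 'k \<Rightarrow> int) \<Rightarrow> 'k list \<Rightarrow> 'a" where
  "normal_form x a c [] = \<one>"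
| "normal_form x a c (k # ks) =
    x k [^] a k \<otimes> normal_form x a c ks \<otimes> commutator G (ordered_prod x (\<lambda>i. c i k) ks) (x k)"

lemma ordered_prod_closed [simp]:
  "(\<And>k. k \<in> set ks \<Longrightarrow> x k \<in> carrier G) \<Longrightarrow> ordered_prod x f ks \<in> carrier G"
  by (induction ks) auto

lemma normal_form_closed [simp]:
  "(\<And>k. k \<in> set ks \<Longrightarrow> x k \<in> carrier G) \<Longrightarrow> normal_form x a c ks \<in> carrier G"
  by (induction ks) auto

lemma ordered_prod_cong:
  "(\<And>i. i \<in> set ks \<Longrightarrow> f i = f' i) \<Longrightarrow> ordered_prod x f ks = ordered_prod x f' ks"
  by (induction ks) auto

lemma ordered_prod_zero: "(\<And>i. i \<in> set ks \<Longrightarrow> f i = 0) \<Longrightarrow> ordered_prod x f ks = \<one>"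
  by (induction ks) auto

lemma normal_form_cong:
  assumes "distinct ks" "\<And>i. i \<in> set ks \<Longrightarrow> a i = a' i"
    "\<And>i j. i \<in> set ks \<Longrightarrow> j \<in> set ks \<Longrightarrow> i \<noteq> j \<Longrightarrow> c i j = c' i j"
  shows "normal_form x a c ks = normal_form x a' c' ks"
  using assms
proof (induction ks)
  case (Cons k ks)
  then have "ordered_prod x (\<lambda>i. c i k) ks = ordered_prod x (\<lambda>i. c' i k) ks"
    by (intro ordered_prod_cong) auto
  then show ?case
    using Cons by auto
qed simp

end

text \<open>
  Groups of nilpotency class at most 2.  In them the commutator is bilinear.
\<close>

locale class_two_group = group +
  assumes commutator_central:
    "\<lbrakk>x \<in> carrier G; y \<in> carrier G; z \<in> carrier G\<rbrakk>
      \<Longrightarrow> commutator G x y \<otimes> z = z \<otimes> commutator G x y"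
begin

lemma commutator_mult_left:
  assumes [simp]: "x \<in> carrier G" "x' \<in> carrier G" "y \<in> carrier G"
  shows "commutator G (x \<otimes> x') y = commutator G x y \<otimes> commutator G x' y"
proof (rule commutator_eqI)
  have "x \<otimes> x' \<otimes> y = x \<otimes> (commutator G x' y \<otimes> (y \<otimes> x'))"
    by (simp add: m_assoc mult_eq_commutator_mult[of x' y])
  also have "\<dots> = commutator G x' y \<otimes> (x \<otimes> y) \<otimes> x'"
    by (simp add: commutator_central[of x' y x] flip: m_assoc)
  also have "\<dots> = commutator G x' y \<otimes> commutator G x y \<otimes> (y \<otimes> (x \<otimes> x'))"
    by (simp add: mult_eq_commutator_mult[of x y] m_assoc)
  also have "commutator G x' y \<otimes> commutator G x y = commutator G x y \<otimes> commutator G x' y"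
    by (rule commutator_central) simp_all
  finally show "x \<otimes> x' \<otimes> y = commutator G x y \<otimes> commutator G x' y \<otimes> (y \<otimes> (x \<otimes> x'))" .
qed simp_all

lemma commutator_mult_right:
  assumes [simp]: "x \<in> carrier G" "y \<in> carrier G" "y' \<in> carrier G"
  shows "commutator G x (y \<otimes> y') = commutator G x y \<otimes> commutator G x y'"
proof (rule commutator_eqI)
  have "x \<otimes> (y \<otimes> y') = commutator G x y \<otimes> y \<otimes> (x \<otimes> y')"
    by (simp add: mult_eq_commutator_mult[of x y] flip: m_assoc)
  also have "\<dots> = commutator G x y \<otimes> (y \<otimes> commutator G x y') \<otimes> (y' \<otimes> x)"
    by (simp add: mult_eq_commutator_mult[of x y'] m_assoc)
  also have "y \<otimes> commutator G x y' = commutator G x y' \<otimes> y"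
    by (simp add: commutator_central)
  finally show "x \<otimes> (y \<otimes> y') = commutator G x y \<otimes> commutator G x y' \<otimes> (y \<otimes> y' \<otimes> x)"
    by (simp add: m_assoc)
qed simp_all

lemma commutator_one_left [simp]: "y \<in> carrier G \<Longrightarrow> commutator G \<one> y = \<one>"
  by (rule commutator_eqI) simp_all

lemma commutator_pow_left:
  assumes "x \<in> carrier G" "y \<in> carrier G"
  shows "commutator G (x [^] n) y = commutator G x y [^] (n :: int)"
proof (rule hom_int_pow)
  show "(\<lambda>x. commutator G x y) \<in> hom G G"
    using assms by (intro homI) (simp_all add: commutator_mult_left)
qed (use assms group_axioms in auto)

lemma commutator_pow_right:
  assumes "x \<in> carrier G" "y \<in> carrier G"
  shows "commutator G x (y [^] n) = commutator G x y [^] (n :: int)"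
proof (rule hom_int_pow)
  show "commutator G x \<in> hom G G"
    using assms by (intro homI) (simp_all add: commutator_mult_right)
qed (use assms group_axioms in auto)

lemma commutator_commutator_left [simp]:
  assumes "x \<in> carrier G" "y \<in> carrier G" "z \<in> carrier G"
  shows "commutator G (commutator G x y) z = \<one>"
  using assms by (intro commutator_eqI) (simp_all add: commutator_central[of x y z])

lemma commutator_ordered_prod_add:
  assumes "\<And>k. k \<in> set ks \<Longrightarrow> x k \<in> carrier G" "y \<in> carrier G"
  shows "commutator G (ordered_prod x f ks) y \<otimes> commutator G (ordered_prod x g ks) y
    = commutator G (ordered_prod x (\<lambda>i. f i + g i) ks) y"
  using assms
proof (induction ks)
  case (Cons k ks)
  let ?F = "ordered_prod x f ks" and ?g = "x k [^] g k"
  have [simp]: "x k \<in> carrier G" "?F \<in> carrier G" "ordered_prod x g ks \<in> carrier G"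
    "ordered_prod x (\<lambda>i. f i + g i) ks \<in> carrier G" "y \<in> carrier G"
    using Cons.prems by auto
  have swap: "commutator G ?F y \<otimes> (commutator G ?g y \<otimes> z)
      = commutator G ?g y \<otimes> (commutator G ?F y \<otimes> z)" if "z \<in> carrier G" for z
    using that commutator_central[of ?F y "commutator G ?g y"] by (simp flip: m_assoc)
  have "commutator G ?F y \<otimes> commutator G (ordered_prod x g ks) y
    = commutator G (ordered_prod x (\<lambda>i. f i + g i) ks) y"
    using Cons by simp
  then show ?case
    by (simp add: commutator_mult_left m_assoc swap int_pow_mult)
qed simp

lemma commutator_ordered_prod_pow:
  assumes "\<And>k. k \<in> set ks \<Longrightarrow> x k \<in> carrier G" "y \<in> carrier G"
  shows "commutator G (ordered_prod x f ks) (y [^] s)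
    = commutator G (ordered_prod x (\<lambda>i. s * f i) ks) y"
  using assms
proof (induction ks)
  case (Cons k ks)
  have carr: "x k \<in> carrier G" "ordered_prod x f ks \<in> carrier G"
    "ordered_prod x (\<lambda>i. s * f i) ks \<in> carrier G"
    using Cons.prems by auto
  have "commutator G (x k [^] f k) (y [^] s) = commutator G (x k [^] (s * f k)) y"
    using carr \<open>y \<in> carrier G\<close>
    by (simp add: commutator_pow_left commutator_pow_right int_pow_pow mult.commute)
  then show ?case
    using Cons carr by (simp add: commutator_mult_left)
qed simp

lemma commutator_normal_form:
  assumes "\<And>k. k \<in> set ks \<Longrightarrow> x k \<in> carrier G" "y \<in> carrier G"
  shows "commutator G (normal_form x a c ks) y = commutator G (ordered_prod x a ks) y"
  using assms by (induction ks) (simp_all add: commutator_mult_left)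

text \<open>
  The collection step: moving \<open>x\<^sub>m\<^sup>s\<close> from the right end to its place, past the powers
  \<open>x\<^sub>i\<^bsup>a i\<^esup>\<close> with \<open>i\<close> after \<open>m\<close>, produces the commutators \<open>[x\<^sub>i, x\<^sub>m]\<^bsup>s a i\<^esup>\<close>.  The entries of
  \<open>c\<close> that are changed although \<open>i\<close> is not after \<open>m\<close> do not occur in the collected form.
\<close>

lemma normal_form_mult_pow:
  assumes "\<And>k. k \<in> set ks \<Longrightarrow> x k \<in> carrier G" "distinct ks" "m \<in> set ks"
  shows "normal_form x a c ks \<otimes> x m [^] s
    = normal_form x (a(m := a m + s)) (\<lambda>i j. c i j + (if j = m then s * a i else 0)) ks"
    (is "_ = normal_form x ?a ?c ks")
  using assms
proof (induction ks)
  case (Cons k ks)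
  let ?N = "normal_form x a c ks" and ?D = "commutator G (ordered_prod x (\<lambda>i. c i k) ks) (x k)"
  have carr [simp]: "x k \<in> carrier G" "\<And>f. ordered_prod x f ks \<in> carrier G"
    "\<And>a c. normal_form x a c ks \<in> carrier G" "x m \<in> carrier G"
    using Cons.prems by auto
  have D: "x k [^] a k \<otimes> ?N \<otimes> ?D \<otimes> x m [^] s = x k [^] a k \<otimes> (?N \<otimes> x m [^] s) \<otimes> ?D"
    by (simp add: m_assoc commutator_central[of _ "x k" "x m [^] s"])
  show ?case
  proof (cases "m = k")
    case True
    let ?y = "x k [^] s"
    have "?N \<otimes> ?y = commutator G ?N ?y \<otimes> (?y \<otimes> ?N)"
      by (rule mult_eq_commutator_mult) simp_all
    also have "\<dots> = ?y \<otimes> ?N \<otimes> commutator G ?N ?y"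
      by (rule commutator_central) simp_all
    also have "commutator G ?N ?y = commutator G (ordered_prod x (\<lambda>i. s * a i) ks) (x k)"
      using Cons.prems by (simp add: commutator_normal_form commutator_ordered_prod_pow)
    finally have "x k [^] a k \<otimes> ?N \<otimes> ?D \<otimes> ?y = (x k [^] a k \<otimes> ?y) \<otimes> ?N
        \<otimes> (commutator G (ordered_prod x (\<lambda>i. s * a i) ks) (x k) \<otimes> ?D)"
      using D True by (simp add: m_assoc)
    moreover have "x k [^] a k \<otimes> ?y = x k [^] ?a k"
      using True by (simp add: int_pow_mult)
    moreover have "commutator G (ordered_prod x (\<lambda>i. s * a i) ks) (x k) \<otimes> ?D
        = commutator G (ordered_prod x (\<lambda>i. ?c i k) ks) (x k)"
      using Cons.prems True by (simp add: commutator_ordered_prod_add add.commute)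
    moreover have "?N = normal_form x ?a ?c ks"
      using Cons.prems True by (intro normal_form_cong) auto
    ultimately show ?thesis
      using True by (simp only: normal_form.simps)
  next
    case False
    then have "?N \<otimes> x m [^] s = normal_form x ?a ?c ks"
      using Cons.prems by (intro Cons.IH) auto
    moreover have "?a k = a k" "(\<lambda>i. ?c i k) = (\<lambda>i. c i k)"
      using False by auto
    ultimately show ?thesis
      using D by (simp only: normal_form.simps)
  qed
qed simp

end

section \<open>The second and third terms for a free group\<close>

lemma carrier_free_group: "carrier (free_group X) = {ws. reduced ws \<and> fst ` set ws \<subseteq> X}"
  and mult_free_group: "u \<otimes>\<^bsub>free_group X\<^esub> v = free_reduce (u @ v)"
  and one_free_group: "\<one>\<^bsub>free_group X\<^esub> = []"
  by (simp_all add: free_group_def)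

lemma inv_letter_free_group:
  assumes "k \<in> X"
  shows "inv\<^bsub>free_group X\<^esub> [(k, True)] = [(k, False)]"
proof -
  interpret group "free_group X"
    by (rule group_free_group)
  show ?thesis
    using assms
    by (intro inv_equality)
      (auto simp: carrier_free_group mult_free_group one_free_group reduced_def free_reduce_def
        inv_letter_def)
qed

text \<open>
  Appending a letter changes the exponent sums and the pair counts of a word in the same way as
  \<open>normal_form_mult_pow\<close> changes the exponents of the collected form.
\<close>

lemma hom_free_group_eq_normal_form:
  assumes "class_two_group H" and h: "h \<in> hom (free_group X) H"
    and ks: "distinct ks" "set ks = X" and u: "u \<in> carrier (free_group X)"
  shows "h u = group.normal_form H (\<lambda>k. h [(k, True)]) (\<lambda>i. exponent i u)
    (\<lambda>i j. pair_count i j u) ks"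
  using u
proof (induction u rule: rev_induct)
  case Nil
  interpret H: class_two_group H by fact
  have "h [] = \<one>\<^bsub>H\<^esub>"
    using hom_one[OF h group_free_group H.group_axioms] by (simp add: one_free_group)
  moreover have "H.normal_form (\<lambda>k. h [(k, True)]) (\<lambda>i. 0) (\<lambda>i j. 0) ls = \<one>\<^bsub>H\<^esub>"
    if "set ls \<subseteq> X" for ls
    using that hom_in_carrier[OF h, of "[(_, True)]"]
    by (induction ls) (auto simp: H.ordered_prod_zero carrier_free_group reduced_def)
  ultimately show ?case
    using ks by simp
next
  case (snoc l u)
  interpret H: class_two_group H by fact
  interpret F: group "free_group X" by (rule group_free_group)
  let ?x = "\<lambda>k. h [(k, True)]"
  obtain m b where l: "l = (m, b)" by (cases l)
  have red: "reduced (u @ [l])" and m: "m \<in> X"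
    using snoc.prems l by (auto simp: carrier_free_group)
  have gen: "[(k, b)] \<in> carrier (free_group X)" if "k \<in> X" for k b
    using that by (simp add: carrier_free_group reduced_def)
  have u: "u \<in> carrier (free_group X)"
    using snoc.prems by (auto simp: carrier_free_group reduced_def successively_append_iff)
  let ?s = "letter_exponent m l"
  have hl: "h [l] = ?x m [^]\<^bsub>H\<^esub> ?s"
  proof (cases b)
    case True
    then show ?thesis
      using hom_in_carrier[OF h gen] m by (simp add: l letter_exponent_def)
  next
    case False
    have "h [l] = inv\<^bsub>H\<^esub> (?x m)"
      using group_hom.hom_inv[of "free_group X" H h "[(m, True)]"] gen m h False
      by (simp add: l inv_letter_free_group group_hom_def group_hom_axioms_def F.group_axioms
          H.group_axioms)
    then show ?thesis
      using False hom_in_carrier[OF h gen] m by (simp add: l letter_exponent_def H.int_pow_neg)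
  qed
  have "u @ [l] = u \<otimes>\<^bsub>free_group X\<^esub> [l]"
    using red by (simp add: mult_free_group free_reduce_reduced)
  then have "h (u @ [l]) = h u \<otimes>\<^bsub>H\<^esub> h [l]"
    using hom_mult[OF h u] gen m l by simp
  also have "\<dots> = H.normal_form ?x (\<lambda>i. exponent i u) (\<lambda>i j. pair_count i j u) ks
      \<otimes>\<^bsub>H\<^esub> ?x m [^]\<^bsub>H\<^esub> ?s"
    using snoc.IH u hl by simp
  also have "\<dots> = H.normal_form ?x ((\<lambda>i. exponent i u)(m := exponent m u + ?s))
      (\<lambda>i j. pair_count i j u + (if j = m then ?s * exponent i u else 0)) ks"
    using ks m hom_in_carrier[OF h gen] by (intro H.normal_form_mult_pow) auto
  also have "(\<lambda>i. exponent i u)(m := exponent m u + ?s) = (\<lambda>i. exponent i (u @ [l]))"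
    by (auto simp: l letter_exponent_def)
  also have "(\<lambda>i j. pair_count i j u + (if j = m then ?s * exponent i u else 0))
      = (\<lambda>i j. pair_count i j (u @ [l]))"
    by (auto simp: l letter_exponent_def fun_eq_iff)
  finally show ?case .
qed

text \<open>A quotient in which all threefold commutators die has class at most 2.\<close>

lemma (in normal) class_two_FactGroup:
  assumes "\<And>x y z. \<lbrakk>x \<in> carrier G; y \<in> carrier G; z \<in> carrier G\<rbrakk>
      \<Longrightarrow> commutator G (commutator G x y) z \<in> H"
  shows "class_two_group (G Mod H)"
proof -
  interpret Q: group "G Mod H" by (rule factorgroup_is_group)
  interpret \<pi>: group_hom G "G Mod H" "\<lambda>g. H #> g"
    using r_coset_hom_Mod by unfold_locales
  have comm: "commutator (G Mod H) (H #> x) (H #> y) = H #> commutator G x y"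
    if "x \<in> carrier G" "y \<in> carrier G" for x y
    using that by (simp add: commutator_def)
  show ?thesis
  proof
    fix X Y Z
    assume "X \<in> carrier (G Mod H)" "Y \<in> carrier (G Mod H)" "Z \<in> carrier (G Mod H)"
    then obtain x y z where xyz: "X = H #> x" "Y = H #> y" "Z = H #> z"
      "x \<in> carrier G" "y \<in> carrier G" "z \<in> carrier G"
      unfolding FactGroup_def RCOSETS_def by auto
    let ?c = "commutator G x y"
    have "H #> (?c \<otimes> z) = H #> (commutator G ?c z \<otimes> (z \<otimes> ?c))"
      using xyz mult_eq_commutator_mult[of ?c z] by simp
    also have "\<dots> = H #> (z \<otimes> ?c)"
      using assms[of x y z] xyz
      by (metis coset_mult_assoc commutator_closed m_closed subset rcos_const is_group)
    finally show "commutator (G Mod H) X Y \<otimes>\<^bsub>G Mod H\<^esub> Z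
        = Z \<otimes>\<^bsub>G Mod H\<^esub> commutator (G Mod H) X Y"
      using xyz comm by simp
  qed
qed

lemma exponent_mult [simp]: "exponent i (u \<otimes>\<^bsub>free_group X\<^esub> v) = exponent i u + exponent i v"
  by (simp add: mult_free_group)

lemma pair_count_mult [simp]:
  "i \<noteq> j \<Longrightarrow> pair_count i j (u \<otimes>\<^bsub>free_group X\<^esub> v)
    = pair_count i j u + pair_count i j v + exponent i u * exponent j v"
  by (simp add: mult_free_group)

lemma exponent_inv:
  assumes "u \<in> carrier (free_group X)"
  shows "exponent i (inv\<^bsub>free_group X\<^esub> u) = - exponent i u"
proof -
  have "exponent i (u \<otimes>\<^bsub>free_group X\<^esub> inv\<^bsub>free_group X\<^esub> u) = 0"
    using group.r_inv[OF group_free_group assms] by (simp add: one_free_group)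
  then show ?thesis by simp
qed

lemma pair_count_inv:
  assumes "u \<in> carrier (free_group X)" "i \<noteq> j"
  shows "pair_count i j (inv\<^bsub>free_group X\<^esub> u) = exponent i u * exponent j u - pair_count i j u"
proof -
  have "pair_count i j (u \<otimes>\<^bsub>free_group X\<^esub> inv\<^bsub>free_group X\<^esub> u) = 0"
    using group.r_inv[OF group_free_group assms(1)] by (simp add: one_free_group)
  then show ?thesis using assms by (simp add: exponent_inv)
qed

lemma lower_central_2_exponent:
  assumes "u \<in> lower_central (free_group X) 2"
  shows "exponent i u = 0"
proof -
  interpret group "free_group X" by (rule group_free_group)
  let ?S = "{commutator (free_group X) x y | x y. x \<in> carrier (free_group X) \<and> y \<in> carrier (free_group X)}"
  have S: "?S \<subseteq> carrier (free_group X)" by auto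
  have *: "exponent i v = 0" if "v \<in> ?S" for v
    using that by (auto simp: commutator_def exponent_inv)
  have "u \<in> generate (free_group X) ?S"
    using assms by (simp add: lower_central_2)
  then show ?thesis
  proof (induction rule: generate.induct)
    case one
    then show ?case by (simp add: one_free_group)
  next
    case (incl v)
    then show ?case by (rule *)
  next
    case (inv v)
    then show ?case using *[of v] S by (auto simp: exponent_inv)
  next
    case (eng v w)
    then show ?case by simp
  qed
qed

lemma lower_central_3_pair_count:
  assumes "u \<in> lower_central (free_group X) 3" "i \<noteq> j"
  shows "exponent i u = 0 \<and> exponent j u = 0 \<and> pair_count i j u = 0"
proof -
  interpret group "free_group X" by (rule group_free_group)
  interpret N: normal "lower_central (free_group X) 2" "free_group X"
    by (rule normal_lower_central)
  let ?S = "{commutator (free_group X) x y | x y. x \<in> lower_central (free_group X) 2 \<and> y \<in> carrier (free_group X)}"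
  have S: "?S \<subseteq> carrier (free_group X)"
    using N.mem_carrier by auto
  have *: "exponent i v = 0 \<and> exponent j v = 0 \<and> pair_count i j v = 0" if v: "v \<in> ?S" for v
  proof -
    obtain x y where xy: "v = commutator (free_group X) x y"
      "x \<in> lower_central (free_group X) 2" "y \<in> carrier (free_group X)"
      using v by blast
    have "exponent k x = 0" for k
      using lower_central_2_exponent xy(2) .
    then show ?thesis
      using xy N.mem_carrier assms(2)
      by (simp add: commutator_def exponent_inv pair_count_inv)
  qed
  have "u \<in> generate (free_group X) ?S"
    using assms by (simp add: lower_central_3)
  then show ?thesis
  proof (induction rule: generate.induct)
    case one
    then show ?case by (simp add: one_free_group)
  next
    case (incl v)
    then show ?case by (rule *)
  next
    case (inv v)
    then show ?case
      using *[of v] S assms(2) by (auto simp: exponent_inv pair_count_inv)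
  next
    case (eng v w)
    then show ?case using assms(2) by simp
  qed
qed

lemma commutator_in_lower_central_2:
  "x \<in> carrier G \<Longrightarrow> y \<in> carrier G \<Longrightarrow> commutator G x y \<in> lower_central G 2"
  unfolding lower_central_2 by (blast intro: generate.incl)

lemma commutator_in_lower_central_3:
  "x \<in> lower_central G 2 \<Longrightarrow> y \<in> carrier G \<Longrightarrow> commutator G x y \<in> lower_central G 3"
  unfolding lower_central_3 by (blast intro: generate.incl)

lemma lower_central_2_free_group_iff:
  assumes "finite X" and u: "u \<in> carrier (free_group X)"
  shows "u \<in> lower_central (free_group X) 2 \<longleftrightarrow> (\<forall>i \<in> X. exponent i u = 0)"
proof
  assume zero: "\<forall>i \<in> X. exponent i u = 0"
  let ?G = "free_group X" and ?N = "lower_central (free_group X) 2"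
  interpret group ?G by (rule group_free_group)
  interpret N: normal ?N ?G by (rule normal_lower_central)
  obtain ks where ks: "set ks = X" "distinct ks"
    using finite_distinct_list[OF assms(1)] by blast
  have "class_two_group (?G Mod ?N)"
    by (intro N.class_two_FactGroup commutator_in_lower_central_2) auto
  then interpret Q: class_two_group "?G Mod ?N" .
  interpret \<pi>: group_hom ?G "?G Mod ?N" "\<lambda>g. ?N #>\<^bsub>?G\<^esub> g"
    using N.r_coset_hom_Mod by unfold_locales
  let ?x = "\<lambda>k. ?N #>\<^bsub>?G\<^esub> [(k, True)]"
  \<comment> \<open>In this quotient the collected form reduces to the powers of the generators.\<close>
  have abelian: "commutator (?G Mod ?N) A B = \<one>\<^bsub>?G Mod ?N\<^esub>"
    if AB: "A \<in> carrier (?G Mod ?N)" "B \<in> carrier (?G Mod ?N)" for A B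
  proof -
    obtain x y where xy: "A = ?N #>\<^bsub>?G\<^esub> x" "B = ?N #>\<^bsub>?G\<^esub> y" "x \<in> carrier ?G" "y \<in> carrier ?G"
      using AB unfolding FactGroup_def RCOSETS_def by auto
    then have "commutator (?G Mod ?N) A B = ?N #>\<^bsub>?G\<^esub> commutator ?G x y"
      by (simp add: commutator_def)
    then show ?thesis
      using xy commutator_in_lower_central_2[of x ?G y] N.rcos_const[OF is_group]
      by simp
  qed
  have x: "?x k \<in> carrier (?G Mod ?N)" if "k \<in> X" for k
    using that by (intro \<pi>.hom_closed) (simp add: carrier_free_group reduced_def)
  have "?N #>\<^bsub>?G\<^esub> u = Q.normal_form ?x (\<lambda>i. exponent i u) (\<lambda>i j. pair_count i j u) ks"
    using hom_free_group_eq_normal_form[OF Q.class_two_group_axioms N.r_coset_hom_Mod ks(2,1) u] .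
  also have "\<dots> = \<one>\<^bsub>?G Mod ?N\<^esub>"
  proof -
    have "Q.normal_form ?x (\<lambda>i. exponent i u) c ls = \<one>\<^bsub>?G Mod ?N\<^esub>" if "set ls \<subseteq> X" for c ls
      using that
    proof (induction ls)
      case (Cons l ls)
      then have "Q.ordered_prod ?x f ls \<in> carrier (?G Mod ?N)" for f
        by (intro Q.ordered_prod_closed x) auto
      then show ?case
        using Cons zero x by (simp add: abelian del: one_FactGroup mult_FactGroup)
    qed simp_all
    then show ?thesis using ks by simp
  qed
  finally have "?N #>\<^bsub>?G\<^esub> u = ?N"
    by simp
  then show "u \<in> ?N"
    using N.subgroup_axioms coset_join1[of ?N u] u N.subset by blast
qed (blast intro: lower_central_2_exponent)

lemma lower_central_3_free_group_iff:
  assumes "finite X" and u: "u \<in> carrier (free_group X)"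
  shows "u \<in> lower_central (free_group X) 3 \<longleftrightarrow> u \<in> lower_central (free_group X) 2
    \<and> (\<forall>i \<in> X. \<forall>j \<in> X. i \<noteq> j \<longrightarrow> pair_count i j u = 0)"
proof
  let ?G = "free_group X" and ?N = "lower_central (free_group X) 3"
  interpret group ?G by (rule group_free_group)
  interpret N: normal ?N ?G by (rule normal_lower_central)
  assume zero: "u \<in> lower_central (free_group X) 2
    \<and> (\<forall>i \<in> X. \<forall>j \<in> X. i \<noteq> j \<longrightarrow> pair_count i j u = 0)"
  obtain ks where ks: "set ks = X" "distinct ks"
    using finite_distinct_list[OF assms(1)] by blast
  have "class_two_group (?G Mod ?N)"
    by (intro N.class_two_FactGroup commutator_in_lower_central_3 commutator_in_lower_central_2)
  then interpret Q: class_two_group "?G Mod ?N" .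
  interpret \<pi>: group_hom ?G "?G Mod ?N" "\<lambda>g. ?N #>\<^bsub>?G\<^esub> g"
    using N.r_coset_hom_Mod by unfold_locales
  let ?x = "\<lambda>k. ?N #>\<^bsub>?G\<^esub> [(k, True)]"
  have x: "?x k \<in> carrier (?G Mod ?N)" if "k \<in> X" for k
    using that by (intro \<pi>.hom_closed) (simp add: carrier_free_group reduced_def)
  have "?N #>\<^bsub>?G\<^esub> u = Q.normal_form ?x (\<lambda>i. exponent i u) (\<lambda>i j. pair_count i j u) ks"
    using hom_free_group_eq_normal_form[OF Q.class_two_group_axioms N.r_coset_hom_Mod ks(2,1) u] .
  also have "\<dots> = Q.normal_form ?x (\<lambda>i. 0) (\<lambda>i j. 0) ks"
    using ks zero lower_central_2_exponent by (intro Q.normal_form_cong) auto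
  \<comment> \<open>The empty word has the same collected form, so it has the same coset.\<close>
  also have "\<dots> = Q.normal_form ?x (\<lambda>i. exponent i []) (\<lambda>i j. pair_count i j []) ks"
    by simp
  also have "\<dots> = ?N #>\<^bsub>?G\<^esub> []"
    using hom_free_group_eq_normal_form[OF Q.class_two_group_axioms N.r_coset_hom_Mod ks(2,1)]
      one_closed unfolding one_free_group by simp
  also have "\<dots> = ?N"
    using \<pi>.hom_one by (simp add: one_free_group)
  finally show "u \<in> ?N"
    using N.subgroup_axioms coset_join1[of ?N u] u N.subset by blast
next
  assume u3: "u \<in> lower_central (free_group X) 3"
  interpret N2: normal "lower_central (free_group X) 2" "free_group X"
    by (intro group.normal_lower_central group_free_group)
  have "lower_central (free_group X) 3 \<subseteq> lower_central (free_group X) 2"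
    unfolding lower_central_3 lower_central_2[of "free_group X"]
    by (intro group.mono_generate[OF group_free_group]) (auto dest: N2.mem_carrier simp flip: lower_central_2)
  then show "u \<in> lower_central (free_group X) 2
    \<and> (\<forall>i \<in> X. \<forall>j \<in> X. i \<noteq> j \<longrightarrow> pair_count i j u = 0)"
    using lower_central_3_pair_count[OF u3] u3 by blast
qed

section \<open>Words of walks on the cube\<close>

text \<open>
  The signed crossing of the \<open>i\<close>-th cotree edge by a step from \<open>u\<close> to \<open>v\<close>; in contrast to
  \<^const>\<open>crossing\<close> it does not refer to a walk that contains the step.
\<close>

definition edge_sign :: "nat \<Rightarrow> nat \<Rightarrow> nat \<Rightarrow> int" where
  "edge_sign i u v =
    (if (u, v) = cotree_edge i then 1 else if (v, u) = cotree_edge i then - 1 else 0)"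

text \<open>The word contributed by a step from \<open>u\<close> to \<open>v\<close>: one letter or none.\<close>

definition edge_word :: "nat \<Rightarrow> nat \<Rightarrow> nat letter list" where
  "edge_word u v = concat (map (\<lambda>i.
     if edge_sign i u v = 1 then [(i, True)]
     else if edge_sign i u v = - 1 then [(i, False)] else []) [1..<6])"

text \<open>
  The unreduced word of the path with directions \<open>ds\<close> from \<open>v\<close>.  The starting vertex is arbitrary,
  so that the word of a walk can be split at any vertex.
\<close>

primrec path_word :: "nat \<Rightarrow> nat list \<Rightarrow> nat letter list" where
  "path_word v [] = []"
| "path_word v (d # ds) = edge_word v (flip_bit d v) @ path_word (flip_bit d v) ds"

lemma path_word_append:
  "path_word v (ds @ es) = path_word v ds @ path_word (fold flip_bit ds v) es"
  by (induction ds arbitrary: v) simp_all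

lemma one_upto_5: "{1..5} = {1, 2, 3, 4, 5::nat}"
  by auto

lemma edge_word_expand:
  "edge_word u v =
     (if (u, v) = (0, 2) then [(1, True)] else if (v, u) = (0, 2) then [(1, False)]
      else if (u, v) = (0, 4) then [(2, True)] else if (v, u) = (0, 4) then [(2, False)]
      else if (u, v) = (1, 5) then [(3, True)] else if (v, u) = (1, 5) then [(3, False)]
      else if (u, v) = (3, 7) then [(4, True)] else if (v, u) = (3, 7) then [(4, False)]
      else if (u, v) = (4, 6) then [(5, True)] else if (v, u) = (4, 6) then [(5, False)]
      else [])"
  by (simp add: edge_word_def edge_sign_def cotree_edge_def upt_rec numeral_eq_Suc)

lemma length_edge_word: "length (edge_word u v) \<le> 1"
  by (simp add: edge_word_expand)

lemma exponent_edge_word: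
  assumes "i \<in> {1..5}"
  shows "exponent i (edge_word u v) = edge_sign i u v"
proof -
  have "exponent i (concat wss) = (\<Sum>ws\<leftarrow>wss. exponent i ws)" for wss :: "nat letter list list"
    by (induction wss) simp_all
  moreover have "exponent i (if edge_sign j u v = 1 then [(j, True)]
      else if edge_sign j u v = - 1 then [(j, False)] else [])
      = (if j = i then edge_sign i u v else 0)" for j
    by (auto simp: edge_sign_def letter_exponent_def)
  ultimately have "exponent i (edge_word u v) = (\<Sum>j\<leftarrow>[1..<6]. if j = i then edge_sign i u v else 0)"
    by (simp add: edge_word_def comp_def)
  then show ?thesis
    using assms by (auto simp: one_upto_5 upt_rec)
qed

lemma pair_count_edge_word: "pair_count i j (edge_word u v) = 0"
  by (simp add: edge_word_expand)

lemma length_path_word: "length (path_word v ds) \<le> length ds"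
proof (induction ds arbitrary: v)
  case (Cons d ds)
  show ?case
    using Cons[of "flip_bit d v"] length_edge_word[of v "flip_bit d v"] by simp
qed simp

lemma walk_vertex_append: "k \<le> length w \<Longrightarrow> walk_vertex (w @ u) k = walk_vertex w k"
  by (simp add: walk_vertex_def)

lemma walk_vertex_length: "walk_vertex w (length w) = fold flip_bit w 0"
  by (simp add: walk_vertex_def)

lemma walk_vertex_snoc: "walk_vertex (w @ [d]) (Suc (length w)) = flip_bit d (fold flip_bit w 0)"
  by (simp add: walk_vertex_def)

lemma crossing_append: "k \<le> length w \<Longrightarrow> crossing (w @ u) i k = crossing w i k"
  by (simp add: crossing_def walk_vertex_append)

lemma crossing_snoc:
  "crossing (w @ [d]) i (Suc (length w))
    = edge_sign i (fold flip_bit w 0) (flip_bit d (fold flip_bit w 0))"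
  by (simp add: crossing_def edge_sign_def walk_vertex_append walk_vertex_length walk_vertex_snoc)

lemma crossing_sum_append:
  "k \<le> length w \<Longrightarrow> crossing_sum (w @ u) i k = crossing_sum w i k"
  unfolding crossing_sum_def by (intro sum.cong) (auto simp: crossing_append)

lemma rho_eq_free_reduce: "rho w = free_reduce (path_word 0 w)"
proof -
  have "concat (map (step_word w) [1..<Suc (length w)]) = path_word 0 w"
  proof (induction w rule: rev_induct)
    case (snoc d w)
    have "step_word (w @ [d]) k = step_word w k" if "k \<le> length w" for k
      using that by (simp add: step_word_def crossing_append cong: if_cong)
    then have "map (step_word (w @ [d])) [1..<Suc (length w)]
        = map (step_word w) [1..<Suc (length w)]"
      by (intro map_cong) auto
    moreover have "step_word (w @ [d]) (Suc (length w))
        = edge_word (fold flip_bit w 0) (flip_bit d (fold flip_bit w 0))"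
      by (simp add: step_word_def edge_word_def crossing_snoc cong: if_cong)
    moreover have "[1..<Suc (length (w @ [d]))] = [1..<Suc (length w)] @ [Suc (length w)]"
      by simp
    ultimately show ?case
      using snoc by (simp only: map_append concat_append path_word_append) simp
  qed simp
  then show ?thesis
    by (simp add: rho_def)
qed

lemma crossing_sum_eq_exponent:
  assumes "i \<in> {1..5}"
  shows "crossing_sum w i (length w) = exponent i (path_word 0 w)"
proof (induction w rule: rev_induct)
  case (snoc d w)
  have "crossing_sum (w @ [d]) i (length (w @ [d]))
      = crossing_sum (w @ [d]) i (length w) + crossing (w @ [d]) i (Suc (length w))"
    by (simp add: crossing_sum_def)
  then show ?case
    using snoc assms by (simp add: crossing_sum_append crossing_snoc path_word_append exponent_edge_word)
qed (simp add: crossing_sum_def)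

lemma mu_eq_pair_count:
  assumes "i \<in> {1..5}" "j \<in> {1..5}"
  shows "mu w i j = pair_count i j (path_word 0 w) - pair_count j i (path_word 0 w)"
proof (induction w rule: rev_induct)
  case (snoc d w)
  let ?n = "length w"
  have "(\<Sum>k = 1..?n. crossing_sum (w @ [d]) i (k - 1) * crossing (w @ [d]) j k
        - crossing_sum (w @ [d]) j (k - 1) * crossing (w @ [d]) i k) = mu w i j"
    unfolding mu_def by (intro sum.cong) (auto simp: crossing_append crossing_sum_append)
  then have "mu (w @ [d]) i j = mu w i j
      + (crossing_sum w i ?n * crossing (w @ [d]) j (Suc ?n)
        - crossing_sum w j ?n * crossing (w @ [d]) i (Suc ?n))"
    by (simp add: mu_def crossing_sum_append)
  then show ?case
    using snoc assms
    by (simp add: path_word_append crossing_snoc crossing_sum_eq_exponent exponent_edge_word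
        pair_count_edge_word)
qed (simp add: mu_def)

lemma a_zero_iff: "a_zero w \<longleftrightarrow> rho w \<in> lower_central F5 2"
proof -
  have "a_zero w \<longleftrightarrow> (\<forall>i \<in> {1..5}. exponent i (rho w) = 0)"
    unfolding a_zero_def rho_eq_free_reduce exponent_free_reduce
    by (intro ball_cong refl) (simp only: crossing_sum_eq_exponent)
  then show ?thesis
    using lower_central_2_free_group_iff[OF _ rho_in_F5] by blast
qed

lemma mu_zero_iff:
  assumes "a_zero w"
  shows "mu_zero w \<longleftrightarrow> rho w \<in> lower_central F5 3"
proof -
  let ?u = "path_word 0 w"
  have shuffle: "pair_count j i ?u = - pair_count i j ?u" if "i \<in> {1..5}" "j \<in> {1..5}" "i \<noteq> j" for i j
  proof -
    have "exponent i ?u = 0"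
      using assms that by (simp add: a_zero_def crossing_sum_eq_exponent)
    then show ?thesis
      using pair_count_shuffle[OF that(3), of ?u] by simp
  qed
  have mu2: "mu w i j = 2 * pair_count i j ?u" if "i \<in> {1..5}" "j \<in> {1..5}" "i \<noteq> j" for i j
    using shuffle[OF that] mu_eq_pair_count[OF that(1,2), of w] by simp
  have "mu_zero w \<longleftrightarrow> (\<forall>i\<in>{1..5}. \<forall>j\<in>{1..5}. i \<noteq> j \<longrightarrow> pair_count i j ?u = 0)"
  proof
    assume zero: "mu_zero w"
    show "\<forall>i\<in>{1..5}. \<forall>j\<in>{1..5}. i \<noteq> j \<longrightarrow> pair_count i j ?u = 0"
    proof (intro ballI impI)
      fix i j :: nat
      assume ij: "i \<in> {1..5}" "j \<in> {1..5}" "i \<noteq> j"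
      then consider "i < j" | "j < i" by linarith
      then show "pair_count i j ?u = 0"
      proof cases
        case 1
        then show ?thesis
          using zero mu2[OF ij] ij unfolding mu_zero_def by auto
      next
        case 2
        then show ?thesis
          using zero mu2[of j i] shuffle[of j i] ij unfolding mu_zero_def by auto
      qed
    qed
  qed (auto simp: mu_zero_def mu2)
  also have "\<dots> \<longleftrightarrow> (\<forall>i\<in>{1..5}. \<forall>j\<in>{1..5}. i \<noteq> j \<longrightarrow> pair_count i j (rho w) = 0)"
    by (simp add: rho_eq_free_reduce)
  also have "\<dots> \<longleftrightarrow> rho w \<in> lower_central F5 3"
    using assms lower_central_3_free_group_iff[OF _ rho_in_F5, of w] unfolding a_zero_iff by blast
  finally show ?thesis .
qed

section \<open>Closed walks of length at most 12 with vanishing crossing counts\<close>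

lemma free_reduce_delete:
  assumes "free_reduce v = []"
  shows "free_reduce (u @ v @ t) = free_reduce (u @ t)"
  using free_reduce_append_right[of u "v @ t"] free_reduce_append_left[of v t]
    free_reduce_append_right[of u t] assms
  by simp

lemma edge_word_backtrack: "free_reduce (edge_word u v @ edge_word v u) = []"
proof -
  have "edge_word u v = map inv_letter (rev (edge_word v u))"
    by (simp add: edge_word_expand inv_letter_def)
  then show ?thesis
    by (simp add: free_reduce_inverse)
qed

text \<open>A table of \<^term>\<open>flip_bit\<close> on the vertices of the cube, suited to evaluation by rewriting.\<close>

definition neighbour :: "nat \<Rightarrow> nat \<Rightarrow> nat" where
  "neighbour d v =
    [[1, 0, 3, 2, 5, 4, 7, 6], [2, 3, 0, 1, 6, 7, 4, 5], [4, 5, 6, 7, 0, 1, 2, 3]] ! d ! v"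

text \<open>
  Depth-first search for a path of at most \<open>r\<close> steps from the vertex \<open>v\<close> to 0 that does not
  backtrack, also not against the direction \<open>p\<close> of the preceding step, and that brings the
  crossing counts, now \<open>a\<close>, back to zero.  A step changes at most one count, by one, so a branch
  is dropped when the absolute values of the counts add up to more than the steps left.
  Conditionals rather than connectives make the simplifier skip the dropped branches.
\<close>

primrec balanced_search :: "nat \<Rightarrow> nat \<Rightarrow> nat \<Rightarrow> int list \<Rightarrow> bool" where
  "balanced_search 0 p v a = (v = 0 \<and> list_all (\<lambda>x. x = 0) a)"
| "balanced_search (Suc r) p v a =
    (if (\<Sum>x\<leftarrow>a. \<bar>x\<bar>) \<le> int (Suc r)
     then if v = 0 \<and> list_all (\<lambda>x. x = 0) a then True
          else list_ex (\<lambda>d. if d = p then False else balanced_search r d (neighbour d v)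
             (map (\<lambda>(i, x). x + edge_sign i v (neighbour d v)) (zip [1, 2, 3, 4, 5] a))) [0, 1, 2]
     else False)"

lemma less_8_cases: "v < (8::nat) \<Longrightarrow> v \<in> {0, 1, 2, 3, 4, 5, 6, 7}"
  by auto

lemma flip_bit_eq_neighbour:
  assumes "d \<in> {0, 1, 2}" "v < 8"
  shows "flip_bit d v = neighbour d v" 
  using assms(1) less_8_cases[OF assms(2)]
  by (auto simp: neighbour_def flip_bit_eq_xor push_bit_eq_mult)

lemma neighbour_less: "d \<in> {0, 1, 2} \<Longrightarrow> v < 8 \<Longrightarrow> neighbour d v < 8"
  using less_8_cases[of v] by (auto simp: neighbour_def)

text \<open>
  For \<open>v = 4 b\<^sub>2 + 2 b\<^sub>1 + b\<^sub>0\<close> the sum \<open>v + v div 2 + v div 4\<close> has the parity of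
  \<open>b\<^sub>0 + b\<^sub>1 + b\<^sub>2\<close>, the colour of \<open>v\<close> in the bipartite cube graph.
\<close>

lemma odd_neighbour:
  assumes "d \<in> {0, 1, 2}" "v < 8"
  shows "odd (neighbour d v + neighbour d v div 2 + neighbour d v div 4)
    = even (v + v div 2 + v div 4)"
proof -
  have "\<forall>d \<in> set [0, 1, 2]. \<forall>v \<in> set [0..<8].
    odd (neighbour d v + neighbour d v div 2 + neighbour d v div 4) = even (v + v div 2 + v div 4)"
    by code_simp
  moreover have "d \<in> set [0, 1, 2]" "v \<in> set [0..<8]"
    using assms by simp_all
  ultimately show ?thesis by blast
qed

text \<open>The counts that the path \<open>ds\<close> brings back to zero are minus its own exponent sums.\<close>

lemma balanced_search_complete:
  assumes "set ds \<subseteq> {0, 1, 2}" "v < 8" "length ds \<le> r" "fold flip_bit ds v = 0"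
    "successively (\<noteq>) (p # ds)"
  shows "balanced_search r p v (map (\<lambda>i. - exponent i (path_word v ds)) [1, 2, 3, 4, 5])"
  using assms
proof (induction r arbitrary: p v ds)
  case (Suc r)
  show ?case
  proof (cases ds)
    case Nil
    then show ?thesis
      using Suc.prems by simp
  next
    case (Cons d es)
    let ?v = "neighbour d v"
    let ?a = "\<lambda>ds v. map (\<lambda>i. - exponent i (path_word v ds)) [1, 2, 3, 4, 5]"
    have d: "d \<in> {0, 1, 2}" "d \<noteq> p" and flip: "flip_bit d v = ?v"
      using Suc.prems Cons flip_bit_eq_neighbour by auto
    have "balanced_search r d ?v (?a es ?v)"
      using Suc.prems Cons d flip neighbour_less by (intro Suc.IH) (auto simp: successively_Cons)
    moreover have "?a es ?v = map (\<lambda>(i, x). x + edge_sign i v ?v) (zip [1, 2, 3, 4, 5] (?a ds v))"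
      by (simp add: Cons flip exponent_edge_word)
    ultimately have "list_ex (\<lambda>d. if d = p then False else balanced_search r d (neighbour d v)
        (map (\<lambda>(i, x). x + edge_sign i v (neighbour d v)) (zip [1, 2, 3, 4, 5] (?a ds v)))) [0, 1, 2]"
      unfolding list_ex_iff using d by auto
    moreover have "(\<Sum>x\<leftarrow>?a ds v. \<bar>x\<bar>) \<le> int (Suc r)"
      using sum_abs_exponent_le[of "{1..5}" "path_word v ds"] length_path_word[of v ds] Suc.prems(3)
      by (simp add: one_upto_5[unfolded One_nat_def])
    ultimately show ?thesis
      by (simp only: balanced_search.simps if_True if_cancel split: if_split)
  qed
qed simp

text \<open>
  The search is started after the first step, since it would accept the empty path at 0.
\<close>

lemma balanced_search_fails:
  "\<forall>d \<in> set [0, 1, 2]. \<not> balanced_search 11 d (neighbour d 0)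
     (map (\<lambda>i. edge_sign i 0 (neighbour d 0)) [1, 2, 3, 4, 5])"
  by code_simp

lemma backtrack_exists:
  "\<not> successively (\<noteq>) ds \<Longrightarrow> \<exists>us d vs. ds = us @ [d, d] @ vs"
proof (induction ds)
  case (Cons d ds)
  show ?case
  proof (cases "successively (\<noteq>) ds")
    case True
    then obtain es where "ds = d # es"
      using Cons.prems by (auto simp: successively_Cons neq_Nil_conv)
    then show ?thesis
      by (metis append_Cons append_Nil)
  next
    case False
    then show ?thesis
      using Cons.IH by (metis append_Cons)
  qed
qed simp

lemma short_balanced_walk_backtracks:
  assumes "set ds \<subseteq> {0, 1, 2}" "fold flip_bit ds (0 :: nat) = 0" "length ds \<le> 12" "ds \<noteq> []"
    "\<forall>i \<in> {1..5}. exponent i (path_word 0 ds) = 0"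
  shows "\<not> successively (\<noteq>) ds"
proof
  assume succ: "successively (\<noteq>) ds"
  obtain d es where ds: "ds = d # es"
    using assms(4) by (cases ds) auto
  have d: "d \<in> {0, 1, 2}" and flip: "flip_bit d 0 = neighbour d 0"
    using assms(1) ds flip_bit_eq_neighbour[of d 0] by auto
  have "balanced_search 11 d (neighbour d 0)
      (map (\<lambda>i. - exponent i (path_word (neighbour d 0) es)) [1, 2, 3, 4, 5])"
    using assms succ ds flip d neighbour_less[of d 0] by (intro balanced_search_complete) auto
  moreover have "- exponent i (path_word (neighbour d 0) es) = edge_sign i 0 (neighbour d 0)"
    if "i \<in> {1..5}" for i
    using assms(5) that exponent_edge_word[OF that, of 0 "neighbour d 0"] ds flip by fastforce
  then have "map (\<lambda>i. - exponent i (path_word (neighbour d 0) es)) [1, 2, 3, 4, 5]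
      = map (\<lambda>i. edge_sign i 0 (neighbour d 0)) [1, 2, 3, 4, 5]"
    by simp
  ultimately show False
    using balanced_search_fails d by auto
qed

lemma short_balanced_walk_trivial:
  assumes "set ds \<subseteq> {0, 1, 2}" "fold flip_bit ds (0 :: nat) = 0" "length ds \<le> 12"
    "\<forall>i \<in> {1..5}. exponent i (path_word 0 ds) = 0"
  shows "free_reduce (path_word 0 ds) = []"
  using assms
proof (induction "length ds" arbitrary: ds rule: less_induct)
  case less
  show ?case
  proof (cases "ds = []")
    case True
    then show ?thesis by (simp add: free_reduce_def)
  next
    case False
    then obtain us d vs where ds: "ds = us @ [d, d] @ vs"
      using backtrack_exists[OF short_balanced_walk_backtracks[OF less.prems(1-3) False less.prems(4)]]
      by blast
    let ?v = "fold flip_bit us (0 :: nat)"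
    have flip_flip: "flip_bit d (flip_bit d ?v) = ?v"
      by (simp add: flip_bit_eq_xor xor.assoc)
    have "path_word 0 ds = path_word 0 us
        @ (edge_word ?v (flip_bit d ?v) @ edge_word (flip_bit d ?v) ?v) @ path_word ?v vs"
      by (simp add: ds path_word_append flip_flip)
    then have reduce: "free_reduce (path_word 0 ds) = free_reduce (path_word 0 (us @ vs))"
      by (simp only: free_reduce_delete[OF edge_word_backtrack] path_word_append)
    then have "exponent i (path_word 0 (us @ vs)) = exponent i (path_word 0 ds)" for i
      by (metis exponent_free_reduce)
    then have "free_reduce (path_word 0 (us @ vs)) = []"
      using less.prems ds flip_flip by (intro less.hyps) auto
    then show ?thesis
      using reduce by simp
  qed
qed

lemma closed_walk_parity:
  fixes v :: nat
  assumes "set ds \<subseteq> {0, 1, 2}" "v < 8" "fold flip_bit ds v = 0"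
  shows "even (length ds) = even (v + v div 2 + v div 4)"
  using assms
proof (induction ds arbitrary: v)
  case (Cons d ds)
  then have flip: "flip_bit d v = neighbour d v" "neighbour d v < 8" and d: "d \<in> {0, 1, 2}"
    using flip_bit_eq_neighbour neighbour_less by auto
  have "even (length ds) = even (neighbour d v + neighbour d v div 2 + neighbour d v div 4)"
    using Cons flip by simp
  then show ?case
    using odd_neighbour[OF d Cons.prems(2)] by simp
qed simp

section \<open>The minimal length\<close>

theorem theorem4p4:
  defines "A \<equiv> {w \<in> closed_walks. a_zero w \<and> \<not> mu_zero w}"
    and "B \<equiv> {w \<in> closed_walks. rho w \<in> lower_central F5 2 - lower_central F5 3}"
    and "W \<equiv> [0, 1, 0, 1, 2, 0, 2, 0, 1, 0, 1, 2, 0, 2]"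
  shows "A = B
    \<and> (LEAST n. n \<in> length ` A) = 14
    \<and> (LEAST n. n \<in> length ` B) = 14
    \<and> is_arg_min length (\<lambda>w. w \<in> A) W
    \<and> is_arg_min length (\<lambda>w. w \<in> B) W"
proof -
  have AB: "A = B"
    unfolding A_def B_def using a_zero_iff mu_zero_iff by blast
  have flip: "flip_bit d v = neighbour d v" if "d = 0 \<or> d = 1 \<or> d = 2" "v < 8" for d v :: nat
    using that by (intro flip_bit_eq_neighbour) auto
  have W_end: "fold flip_bit W 0 = (0 :: nat)"
    by (simp add: W_def flip neighbour_def del: flip_bit_0)
  have W_word: "path_word 0 W = [(1, False), (2, True), (3, False), (1, True), (3, True), (2, False)]"
    by (simp add: W_def flip neighbour_def edge_word_expand)
  have "a_zero W"
    unfolding a_zero_def by (simp add: crossing_sum_eq_exponent[simplified] W_word letter_exponent_def one_upto_5[simplified])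
  moreover have "mu W 1 2 = -2"
    using mu_eq_pair_count[of 1 2 W] by (simp add: W_word letter_exponent_def)
  then have "\<not> mu_zero W"
    unfolding mu_zero_def by force
  ultimately have W_in: "W \<in> A"
    using W_end by (simp add: A_def closed_walks_def walk_vertex_length W_def)
  have lower: "14 \<le> length w" if "w \<in> A" for w
  proof (rule ccontr)
    assume short: "\<not> 14 \<le> length w"
    have w: "set w \<subseteq> {0, 1, 2}" "fold flip_bit w (0 :: nat) = 0" "a_zero w" "\<not> mu_zero w"
      using that by (auto simp: A_def closed_walks_def walk_vertex_length)
    have "even (length w)"
      using closed_walk_parity[OF w(1) _ w(2)] by simp
    then have "length w \<noteq> 13" by auto
    then have "length w \<le> 12"
      using short by linarith
    moreover have "\<forall>i \<in> {1..5}. exponent i (path_word 0 w) = 0"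
      using w(3) by (simp add: a_zero_def crossing_sum_eq_exponent)
    ultimately have "rho w = []"
      using short_balanced_walk_trivial w by (simp add: rho_eq_free_reduce)
    then have "rho w \<in> lower_central F5 3"
      using lower_central_3_free_group_iff[of "{1..5}" "rho w"] rho_in_F5[of w] w(3) a_zero_iff[of w]
      by simp
    then show False
      using w mu_zero_iff by blast
  qed
  have "length W = 14"
    by (simp add: W_def)
  then have least: "(LEAST n. n \<in> length ` A) = 14"
    using W_in lower by (intro Least_equality) force+
  have arg_min: "is_arg_min length (\<lambda>w. w \<in> A) W"
    using W_in lower \<open>length W = 14\<close> by (auto simp: is_arg_min_def not_less)
  show ?thesis
    using AB least arg_min by simp
qed

end
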